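(* There exists a uniformly weakly Radon-Nikod\'ym (UWRN) Boolean algebra which is not strongly weakly Radon-Nikod\'ym (SWRN).
   Context: A family $\{a_i:i\in I\}$ in a Boolean algebra is independent if $\bigcap_{i\in I'}a_i\cap\bigcap_{i\in I''}a_i^c\neq 0$ for all finite disjoint $I',I''\subseteq I$. A Boolean algebra $\mathfrak A$ is UWRN if it is generated by a family $\mathcal G=\bigcup_{n\ge 1}\mathcal G_n$ such that, for every $n\ge 1$, $\mathcal G_n$ contains no independent sequence of length $n$. A Boolean algebra is SWRN if it is generated by a family containing no infinite independent sequence. *)

theory Defs
  imports Complex_Main "HOL-Algebra.Lattice"
begin

locale boolean_lattice = bounded_lattice L for L (structure) +
  assumes meet_join_distrib:
      "\<lbrakk> x \<in> carrier L; y \<in> carrier L; z \<in> carrier L \<rbrakk>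
        \<Longrightarrow> x \<sqinter> (y \<squnion> z) = (x \<sqinter> y) \<squnion> (x \<sqinter> z)"
    and complement_exists:
      "x \<in> carrier L \<Longrightarrow> \<exists>y\<in>carrier L. x \<sqinter> y = \<bottom> \<and> x \<squnion> y = \<top>"

definition complement :: "('a, 'b) gorder_scheme \<Rightarrow> 'a \<Rightarrow> 'a" where
  "complement L x =
    (THE y. y \<in> carrier L \<and> x \<sqinter>\<^bsub>L\<^esub> y = \<bottom>\<^bsub>L\<^esub> \<and> x \<squnion>\<^bsub>L\<^esub> y = \<top>\<^bsub>L\<^esub>)"

lemma (in boolean_lattice) complement_unique:
  assumes "x \<in> carrier L"
    and y: "y \<in> carrier L" "x \<sqinter> y = \<bottom>" "x \<squnion> y = \<top>"
    and z: "z \<in> carrier L" "x \<sqinter> z = \<bottom>" "x \<squnion> z = \<top>"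
  shows "y = z"
proof -
  have le: "u \<sqsubseteq> v"
    if u: "u \<in> carrier L" "x \<sqinter> u = \<bottom>" and v: "v \<in> carrier L" "x \<squnion> v = \<top>" for u v
  proof -
    have "u = u \<sqinter> (x \<squnion> v)"
      using u v le_iff_join le_iff_meet top_higher top_closed by (metis meet_comm)
    also have "\<dots> = (u \<sqinter> x) \<squnion> (u \<sqinter> v)"
      using u v by (rule_tac meet_join_distrib) (simp_all add: assms(1))
    also have "\<dots> = \<bottom> \<squnion> (u \<sqinter> v)"
      using u by (metis meet_comm)
    also have "\<dots> = u \<sqinter> v"
      using u v by (metis bottom_closed bottom_lower join_comm le_iff_meet meet_closed)
    finally show ?thesis
      using u v by (metis meet_right)
  qed
  show ?thesis
    using le[of y z] le[of z y] y z by (simp add: le_antisym)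
qed

lemma (in boolean_lattice) complement:
  assumes "x \<in> carrier L"
  shows "complement L x \<in> carrier L"
    and "x \<sqinter> complement L x = \<bottom>"
    and "x \<squnion> complement L x = \<top>"
proof -
  have "\<exists>!y. y \<in> carrier L \<and> x \<sqinter> y = \<bottom> \<and> x \<squnion> y = \<top>"
    using complement_exists[OF assms] complement_unique[OF assms] by blast
  from theI'[OF this]
  show "complement L x \<in> carrier L" "x \<sqinter> complement L x = \<bottom>" "x \<squnion> complement L x = \<top>"
    unfolding complement_def by auto
qed

definition boolean_subalgebra :: "'a set \<Rightarrow> ('a, 'b) gorder_scheme \<Rightarrow> bool" where
  "boolean_subalgebra S L \<longleftrightarrow>
    S \<subseteq> carrier L \<and> \<bottom>\<^bsub>L\<^esub> \<in> S \<and> \<top>\<^bsub>L\<^esub> \<in> S \<and>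
    (\<forall>x\<in>S. complement L x \<in> S) \<and>
    (\<forall>x\<in>S. \<forall>y\<in>S. x \<sqinter>\<^bsub>L\<^esub> y \<in> S \<and> x \<squnion>\<^bsub>L\<^esub> y \<in> S)"

definition generates :: "('a, 'b) gorder_scheme \<Rightarrow> 'a set \<Rightarrow> bool" where
  "generates L G \<longleftrightarrow>
    G \<subseteq> carrier L \<and> \<Inter>{S. boolean_subalgebra S L \<and> G \<subseteq> S} = carrier L"

text \<open>Empty meets are the top element. Independence concerns the indexed family, so
  a family that repeats an element is not independent.\<close>

definition independent_family ::
    "('a, 'b) gorder_scheme \<Rightarrow> 'i set \<Rightarrow> ('i \<Rightarrow> 'a) \<Rightarrow> bool" where
  "independent_family L I a \<longleftrightarrow>
    (\<forall>I' I''. finite I' \<and> finite I'' \<and> I' \<subseteq> I \<and> I'' \<subseteq> I \<and> I' \<inter> I'' = {} \<longrightarrow>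
      \<Sqinter>\<^bsub>L\<^esub> (a ` I') \<sqinter>\<^bsub>L\<^esub> \<Sqinter>\<^bsub>L\<^esub> ((\<lambda>i. complement L (a i)) ` I'') \<noteq> \<bottom>\<^bsub>L\<^esub>)"

definition UWRN :: "('a, 'b) gorder_scheme \<Rightarrow> bool" where
  "UWRN L \<longleftrightarrow>
    (\<exists>G :: nat \<Rightarrow> 'a set. generates L (\<Union>n\<in>{1..}. G n) \<and>
      (\<forall>n\<ge>1. \<not> (\<exists>a. a \<in> {..<n} \<rightarrow> G n \<and> independent_family L {..<n} a)))"

definition SWRN :: "('a, 'b) gorder_scheme \<Rightarrow> bool" where
  "SWRN L \<longleftrightarrow>
    (\<exists>G. generates L G \<and>
      \<not> (\<exists>a :: nat \<Rightarrow> 'a. range a \<subseteq> G \<and> independent_family L UNIV a))"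

end

theory Submission
  imports Defs "HOL-Analysis.Sigma_Algebra" "HOL-Analysis.Continuum_Not_Denumerable"
begin

text \<open>
  The example is the clopen algebra of \<open>A(c)\<^sup>\<omega>\<close>, the countable power of the one-point
  compactification of a discrete set of size continuum. It is realised concretely by the subsets of
  \<open>nat \<Rightarrow> real\<close> generated by the fibres \<open>{x. x n = r}\<close> with \<open>r \<noteq> 0\<close>; the real number \<open>0\<close> acts
  as the point at infinity of each factor.

  This algebra is UWRN because the fibres over one coordinate are pairwise disjoint, so two
  of them are never independent, and there are only countably many coordinates
  (\<open>UWRN_fibre_algebra\<close>).

  It is not SWRN because every generating family \<open>G\<close> must contain an independent sequence. For each
  coordinate \<open>n\<close> and each \<open>r \<noteq> 0\<close> some \<open>g n r \<in> G\<close> separates the origin from the point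
  obtained by changing its \<open>n\<close>-th coordinate to \<open>r\<close> (\<open>generators_separate\<close>), and membership in
  \<open>g n r\<close> is decided by finitely many tests \<open>x m = s\<close> with \<open>s \<noteq> 0\<close> (\<open>finite_support\<close>). As there
  are uncountably many values \<open>r\<close> for each of countably many coordinates, a Delta-system argument
  (\<open>free_transversal\<close>) picks one value \<open>r n\<close> per coordinate such that \<open>g n (r n)\<close> never tests
  \<open>x m = r m\<close> for \<open>m \<noteq> n\<close>. On the Cantor cube of the points \<open>x\<close> with \<open>x m \<in> {0, r m}\<close>, the
  set \<open>g n (r n)\<close> then depends on the coordinate \<open>n\<close> alone and really depends on it, so
  these sets are independent.
\<close>

section \<open>Algebras of sets as Boolean lattices\<close>

definition set_lattice :: "'a set set \<Rightarrow> 'a set gorder" where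
  "set_lattice M = \<lparr>carrier = M, eq = (=), le = (\<subseteq>)\<rparr>"

lemma set_lattice_simps [simp]:
  "carrier (set_lattice M) = M"
  "(.=\<^bsub>set_lattice M\<^esub>) = (=)"
  "A \<sqsubseteq>\<^bsub>set_lattice M\<^esub> B \<longleftrightarrow> A \<subseteq> B"
  by (simp_all add: set_lattice_def)

lemma partial_order_set_lattice: "partial_order (set_lattice M)"
  by unfold_locales auto

lemma greatest_set_lattice_Inter:
  assumes "\<A> \<subseteq> M" "\<Inter>\<A> \<in> M"
  shows "greatest (set_lattice M) (\<Inter>\<A>) (Lower (set_lattice M) \<A>)"
  using assms by (auto simp: greatest_def Lower_def)

lemma least_set_lattice_Union:
  assumes "\<A> \<subseteq> M" "\<Union>\<A> \<in> M"
  shows "least (set_lattice M) (\<Union>\<A>) (Upper (set_lattice M) \<A>)"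
  using assms by (auto simp: least_def Upper_def)

lemma inf_set_lattice:
  assumes "\<A> \<subseteq> M" "\<Inter>\<A> \<in> M"
  shows "\<Sqinter>\<^bsub>set_lattice M\<^esub> \<A> = \<Inter>\<A>"
proof -
  interpret partial_order "set_lattice M" by (rule partial_order_set_lattice)
  show ?thesis
    unfolding Lattice.inf_def
    using greatest_set_lattice_Inter[OF assms] by (rule some_equality) (rule greatest_unique[OF _ greatest_set_lattice_Inter[OF assms]])
qed

lemma sup_set_lattice:
  assumes "\<A> \<subseteq> M" "\<Union>\<A> \<in> M"
  shows "\<Squnion>\<^bsub>set_lattice M\<^esub> \<A> = \<Union>\<A>"
proof -
  interpret partial_order "set_lattice M" by (rule partial_order_set_lattice)
  show ?thesis
    unfolding Lattice.sup_def
    using least_set_lattice_Union[OF assms] by (rule some_equality) (rule least_unique[OF _ least_set_lattice_Union[OF assms]])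
qed

context
  fixes M :: "'a set set"
  assumes alg: "algebra UNIV M"
begin

interpretation algebra UNIV M by (rule alg)

lemma meet_set_lattice: "A \<in> M \<Longrightarrow> B \<in> M \<Longrightarrow> A \<sqinter>\<^bsub>set_lattice M\<^esub> B = A \<inter> B"
  by (simp add: meet_def inf_set_lattice Int)

lemma join_set_lattice: "A \<in> M \<Longrightarrow> B \<in> M \<Longrightarrow> A \<squnion>\<^bsub>set_lattice M\<^esub> B = A \<union> B"
  by (simp add: join_def sup_set_lattice Un)

lemma bounded_lattice_set_lattice: "bounded_lattice (set_lattice M)"
proof -
  interpret partial_order "set_lattice M" by (rule partial_order_set_lattice)
  have "least (set_lattice M) {} M" "greatest (set_lattice M) UNIV M"
    using top by (auto simp: least_def greatest_def)
  moreover have "\<exists>s. least (set_lattice M) s (Upper (set_lattice M) {A, B})"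
    if "A \<in> M" "B \<in> M" for A B
    using that by (auto intro: least_set_lattice_Union)
  moreover have "\<exists>s. greatest (set_lattice M) s (Lower (set_lattice M) {A, B})"
    if "A \<in> M" "B \<in> M" for A B
    using greatest_set_lattice_Inter[of "{A, B}" M] that by auto
  ultimately show ?thesis
    by unfold_locales auto
qed

lemma bottom_set_lattice: "\<bottom>\<^bsub>set_lattice M\<^esub> = {}"
  using bounded_lattice.bottom_eq[OF bounded_lattice_set_lattice, of "{}"] by simp

lemma top_set_lattice: "\<top>\<^bsub>set_lattice M\<^esub> = UNIV"
  using bounded_lattice.top_eq[OF bounded_lattice_set_lattice, of UNIV] top by simp

lemma Compl_in: "A \<in> M \<Longrightarrow> - A \<in> M"
  using compl_sets[of A] by (simp add: Compl_eq_Diff_UNIV)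

lemma boolean_lattice_set_lattice: "boolean_lattice (set_lattice M)"
proof -
  interpret bounded_lattice "set_lattice M" by (rule bounded_lattice_set_lattice)
  show ?thesis
  proof
    fix A assume "A \<in> carrier (set_lattice M)"
    then show "\<exists>B\<in>carrier (set_lattice M).
        A \<sqinter>\<^bsub>set_lattice M\<^esub> B = \<bottom>\<^bsub>set_lattice M\<^esub> \<and> A \<squnion>\<^bsub>set_lattice M\<^esub> B = \<top>\<^bsub>set_lattice M\<^esub>"
      using Compl_in[of A]
      by (intro bexI[of _ "- A"])
        (auto simp: meet_set_lattice join_set_lattice bottom_set_lattice top_set_lattice)
  qed (auto simp: meet_set_lattice join_set_lattice Int Un)
qed

lemma complement_set_lattice:
  assumes "A \<in> M"
  shows "complement (set_lattice M) A = - A"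
proof -
  interpret boolean_lattice "set_lattice M" by (rule boolean_lattice_set_lattice)
  show ?thesis
    using complement[of A] complement_unique[of A "complement (set_lattice M) A" "- A"]
      assms Compl_in[OF assms]
    by (simp add: meet_set_lattice join_set_lattice bottom_set_lattice top_set_lattice)
qed

lemma boolean_subalgebra_set_lattice:
  "boolean_subalgebra S (set_lattice M) \<longleftrightarrow> S \<subseteq> M \<and> algebra UNIV S"
proof
  assume "S \<subseteq> M \<and> algebra UNIV S"
  then have "S \<subseteq> M" "algebra UNIV S" by auto
  interpret S: algebra UNIV S by fact
  show "boolean_subalgebra S (set_lattice M)"
    using \<open>S \<subseteq> M\<close> S.top
    by (auto simp: boolean_subalgebra_def bottom_set_lattice top_set_lattice subset_iff
        complement_set_lattice meet_set_lattice join_set_lattice Compl_eq_Diff_UNIV)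
next
  assume S: "boolean_subalgebra S (set_lattice M)"
  then have "S \<subseteq> M" by (simp add: boolean_subalgebra_def)
  moreover have "- A \<in> S" "A \<inter> B \<in> S" if "A \<in> S" "B \<in> S" for A B
  proof -
    have "A \<in> M" "B \<in> M" using that \<open>S \<subseteq> M\<close> by auto
    then show "- A \<in> S" "A \<inter> B \<in> S"
      using S that unfolding boolean_subalgebra_def
      by (metis complement_set_lattice, metis meet_set_lattice)
  qed
  ultimately show "S \<subseteq> M \<and> algebra UNIV S"
    using S
    by (auto simp: boolean_subalgebra_def bottom_set_lattice algebra_iff_Int
        simp flip: Compl_eq_Diff_UNIV)
qed

text \<open>Since \<open>M\<close> is itself among the subalgebras that are intersected, generation is a minimality
  property.\<close>

lemma generates_set_lattice:
  "generates (set_lattice M) G \<longleftrightarrow>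
    G \<subseteq> M \<and> (\<forall>S\<subseteq>M. algebra UNIV S \<and> G \<subseteq> S \<longrightarrow> S = M)"
  unfolding generates_def boolean_subalgebra_set_lattice using alg by auto

text \<open>A nonzero element of an algebra of sets is a nonempty set, so independence says that
  every finite pattern of memberships is realised by a point.\<close>

lemma independent_family_set_lattice:
  assumes "a ` I \<subseteq> M"
  shows "independent_family (set_lattice M) I a \<longleftrightarrow>
    (\<forall>I' I''. finite I' \<and> finite I'' \<and> I' \<subseteq> I \<and> I'' \<subseteq> I \<and> I' \<inter> I'' = {} \<longrightarrow>
      (\<exists>x. (\<forall>i\<in>I'. x \<in> a i) \<and> (\<forall>i\<in>I''. x \<notin> a i)))"
proof -
  have meets: "\<Sqinter>\<^bsub>set_lattice M\<^esub> (a ` I') \<sqinter>\<^bsub>set_lattice M\<^esub>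
        \<Sqinter>\<^bsub>set_lattice M\<^esub> ((\<lambda>i. complement (set_lattice M) (a i)) ` I'') = \<bottom>\<^bsub>set_lattice M\<^esub>
      \<longleftrightarrow> \<not> (\<exists>x. (\<forall>i\<in>I'. x \<in> a i) \<and> (\<forall>i\<in>I''. x \<notin> a i))"
    if fin: "finite I'" "finite I''" and sub: "I' \<subseteq> I" "I'' \<subseteq> I" for I' I''
  proof -
    have finite_Inter: "\<Inter>\<A> \<in> M" if "finite \<A>" "\<A> \<subseteq> M" for \<A>
      using that by (induction \<A>) (auto simp: top)
    have c: "(\<lambda>i. complement (set_lattice M) (a i)) ` I'' = (\<lambda>i. - a i) ` I''"
      using assms sub by (auto simp: complement_set_lattice image_subset_iff intro!: image_cong)
    have m: "a ` I' \<subseteq> M" "(\<lambda>i. - a i) ` I'' \<subseteq> M"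
      using assms sub Compl_in by auto
    have "\<Inter> (a ` I') \<in> M" "\<Inter> ((\<lambda>i. - a i) ` I'') \<in> M"
      using m fin by (auto intro!: finite_Inter simp del: Inter_iff)
    with m show ?thesis
      unfolding c by (simp add: inf_set_lattice meet_set_lattice bottom_set_lattice) blast
  qed
  show ?thesis
    unfolding independent_family_def by (intro all_cong1 imp_cong refl) (simp add: meets)
qed

end

section \<open>The algebra generated by the coordinate fibres\<close>

definition coordinate_fibre :: "nat \<Rightarrow> real \<Rightarrow> (nat \<Rightarrow> real) set" where
  "coordinate_fibre n r = {x. x n = r}"

text \<open>The fibres over \<open>0\<close> are left out on purpose: a test \<open>x m = 0\<close> would notice a change of the
  \<open>m\<close>-th coordinate of the origin to any other value, and no choice of that value could avoid it.\<close>

inductive_set fibre_algebra :: "(nat \<Rightarrow> real) set set" where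
  fibre: "r \<noteq> 0 \<Longrightarrow> coordinate_fibre n r \<in> fibre_algebra"
| empty: "{} \<in> fibre_algebra"
| Compl: "A \<in> fibre_algebra \<Longrightarrow> - A \<in> fibre_algebra"
| Int: "A \<in> fibre_algebra \<Longrightarrow> B \<in> fibre_algebra \<Longrightarrow> A \<inter> B \<in> fibre_algebra"

lemma algebra_fibre_algebra: "algebra UNIV fibre_algebra"
  by (auto simp: algebra_iff_Int Compl_eq_Diff_UNIV[symmetric]
      intro: fibre_algebra.intros)

lemma fibre_algebra_minimal:
  assumes "algebra UNIV S" "\<And>n r. r \<noteq> 0 \<Longrightarrow> coordinate_fibre n r \<in> S"
  shows "fibre_algebra \<subseteq> S"
proof
  interpret algebra UNIV S by fact
  fix A assume "A \<in> fibre_algebra"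
  then show "A \<in> S"
    using assms(2) compl_sets by induction (auto simp: Compl_eq_Diff_UNIV)
qed

text \<open>A pair \<open>(n, r)\<close> stands for the test \<open>x n = r\<close>.\<close>

definition determined_by :: "(nat \<times> real) set \<Rightarrow> (nat \<Rightarrow> real) set \<Rightarrow> bool" where
  "determined_by F A \<longleftrightarrow>
    (\<forall>x y. (\<forall>(n, r)\<in>F. x n = r \<longleftrightarrow> y n = r) \<longrightarrow> (x \<in> A \<longleftrightarrow> y \<in> A))"

lemma finite_support:
  assumes "A \<in> fibre_algebra"
  shows "\<exists>F. finite F \<and> F \<subseteq> UNIV \<times> (- {0}) \<and> determined_by F A"
  using assms
proof induction
  case (fibre r n)
  then show ?case
    by (intro exI[of _ "{(n, r)}"]) (auto simp: determined_by_def coordinate_fibre_def)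
next
  case empty
  then show ?case by (intro exI[of _ "{}"]) (auto simp: determined_by_def)
next
  case (Compl A)
  then show ?case by (auto simp: determined_by_def)
next
  case (Int A B)
  then obtain F F' where
    "finite F" "F \<subseteq> UNIV \<times> (- {0})" "determined_by F A"
    "finite F'" "F' \<subseteq> UNIV \<times> (- {0})" "determined_by F' B"
    by blast
  then show ?case
    by (intro exI[of _ "F \<union> F'"]) (fastforce simp: determined_by_def ball_Un)
qed

text \<open>The generators are split by coordinate. A sequence of length one is independent as soon
  as its entry is neither empty nor everything, so no fibre may go into part \<open>1\<close>; coordinate
  \<open>n\<close> goes to part \<open>n + 2\<close>.\<close>

lemma UWRN_fibre_algebra: "UWRN (set_lattice fibre_algebra)"
proof -
  define G where "G n = (if n \<le> 1 then {} else coordinate_fibre (n - 2) ` (- {0}))" for n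
  have G: "coordinate_fibre n r \<in> G (n + 2)" if "r \<noteq> 0" for n r
    using that by (simp add: G_def)
  have "generates (set_lattice fibre_algebra) (\<Union>n\<in>{1..}. G n)"
    unfolding generates_set_lattice[OF algebra_fibre_algebra]
  proof (intro conjI allI impI)
    show "(\<Union>n\<in>{1..}. G n) \<subseteq> fibre_algebra"
      by (auto simp: G_def intro: fibre_algebra.fibre split: if_splits)
    fix S assume "S \<subseteq> fibre_algebra" "algebra UNIV S \<and> (\<Union>n\<in>{1..}. G n) \<subseteq> S"
    moreover from this have "coordinate_fibre n r \<in> S" if "r \<noteq> 0" for n r
      using G[OF that, of n] by force
    ultimately show "S = fibre_algebra"
      using fibre_algebra_minimal[of S] by blast
  qed
  moreover have "\<not> independent_family (set_lattice fibre_algebra) {..<n} a"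
    if "n \<ge> 1" and a: "a \<in> {..<n} \<rightarrow> G n" for n a
  proof
    assume ind: "independent_family (set_lattice fibre_algebra) {..<n} a"
    have "a 0 \<in> G n" using a \<open>n \<ge> 1\<close> by (simp add: Pi_iff)
    then have "n \<ge> 2" by (auto simp: G_def split: if_splits)
    have fibre: "\<exists>r. r \<noteq> 0 \<and> a i = coordinate_fibre (n - 2) r" if "i < n" for i
    proof -
      have "a i \<in> G n" using a that by blast
      with \<open>n \<ge> 2\<close> show ?thesis by (auto simp: G_def)
    qed
    then have "a ` {..<n} \<subseteq> fibre_algebra"
      by (metis fibre_algebra.fibre image_subsetI lessThan_iff)
    note ind' = ind[unfolded independent_family_set_lattice[OF algebra_fibre_algebra this], rule_format]
    obtain r s where rs: "a 0 = coordinate_fibre (n - 2) r" "a 1 = coordinate_fibre (n - 2) s"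
      using fibre[of 0] fibre[of 1] \<open>n \<ge> 2\<close> by auto
    obtain x where "x \<in> a 0" "x \<in> a 1"
      using ind'[of "{0, 1}" "{}"] \<open>n \<ge> 2\<close> by auto
    moreover obtain y where "y \<in> a 0" "y \<notin> a 1"
      using ind'[of "{0}" "{1}"] \<open>n \<ge> 2\<close> by auto
    \<comment> \<open>Both entries are fibres over the same coordinate: a common point forces them to be equal.\<close>
    ultimately show False
      by (simp add: rs[unfolded One_nat_def] coordinate_fibre_def)
  qed
  ultimately show ?thesis
    unfolding UWRN_def by blast
qed

section \<open>Uncountable families of finite sets\<close>

lemma uncountable_superset: "A \<subseteq> B \<Longrightarrow> uncountable A \<Longrightarrow> uncountable B"
  using countable_subset by metis

text \<open>A weak form of the Delta-system lemma: \<open>R\<close> plays the part of the root. For sets of constant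
  size \<open>k\<close>, either every countable \<open>Z\<close> is avoided by uncountably many members, and the empty root
  will do, or some countable \<open>Z\<close> meets all but countably many of them. In the second case one
  point \<open>z \<in> Z\<close> lies in uncountably many members; it is put into the root and removed
  from these members, which lowers \<open>k\<close>.\<close>

lemma uncountable_finite_sets_root:
  fixes F :: "'i \<Rightarrow> 'b set"
  assumes "uncountable U" "\<And>i. i \<in> U \<Longrightarrow> finite (F i)"
  shows "\<exists>R. finite R \<and> (\<forall>Z. countable Z \<and> Z \<inter> R = {} \<longrightarrow> uncountable {i \<in> U. F i \<inter> Z = {}})"
proof -
  have *: "\<exists>R. finite R \<and> (\<forall>Z. countable Z \<and> Z \<inter> R = {} \<longrightarrow> uncountable {i \<in> U. F i \<inter> Z = {}})"
    if "uncountable U" "\<forall>i\<in>U. finite (F i) \<and> card (F i) = k"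
    for k and U and F :: "'i \<Rightarrow> 'b set"
    using that
  proof (induction k arbitrary: U F)
    case 0
    have "F i = {}" if "i \<in> U" for i using bspec[OF "0.prems"(2) that] card_0_eq[of "F i"] by blast
    then have "{i \<in> U. F i \<inter> Z = {}} = U" for Z by auto
    with "0.prems"(1) show ?case by (intro exI[of _ "{}"]) simp
  next
    case (Suc k)
    show ?case
    proof (cases "\<forall>Z. countable Z \<longrightarrow> uncountable {i \<in> U. F i \<inter> Z = {}}")
      case True
      then show ?thesis by (intro exI[of _ "{}"]) simp
    next
      case False
      then obtain Z where Z: "countable Z" "countable {i \<in> U. F i \<inter> Z = {}}" by blast
      have "\<exists>z\<in>Z. uncountable {i \<in> U. z \<in> F i}"
      proof (rule ccontr)
        assume "\<not> ?thesis"
        then have "countable ({i \<in> U. F i \<inter> Z = {}} \<union> (\<Union>z\<in>Z. {i \<in> U. z \<in> F i}))"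
          using Z by simp
        moreover have "U \<subseteq> {i \<in> U. F i \<inter> Z = {}} \<union> (\<Union>z\<in>Z. {i \<in> U. z \<in> F i})" by blast
        ultimately have "countable U" by (rule countable_subset[rotated])
        with Suc.prems(1) show False by contradiction
      qed
      then obtain z where z: "uncountable {i \<in> U. z \<in> F i}" by blast
      have "\<forall>i\<in>{i \<in> U. z \<in> F i}. finite (F i - {z}) \<and> card (F i - {z}) = k"
        using Suc.prems(2) by (simp add: card_Diff_singleton)
      from Suc.IH[OF z this] obtain R where R: "finite R"
        "\<forall>Z. countable Z \<and> Z \<inter> R = {} \<longrightarrow>
          uncountable {i \<in> {i \<in> U. z \<in> F i}. (F i - {z}) \<inter> Z = {}}"
        by (elim exE conjE)
      have "uncountable {i \<in> U. F i \<inter> Z = {}}" if "countable Z" "Z \<inter> insert z R = {}" for Z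
      proof -
        have "{i \<in> {i \<in> U. z \<in> F i}. (F i - {z}) \<inter> Z = {}} \<subseteq> {i \<in> U. F i \<inter> Z = {}}"
          using that by blast
        moreover have "uncountable {i \<in> {i \<in> U. z \<in> F i}. (F i - {z}) \<inter> Z = {}}"
          using R(2)[rule_format, of Z] that by simp
        ultimately show ?thesis by (rule uncountable_superset)
      qed
      with R(1) show ?thesis by (intro exI[of _ "insert z R"]) blast
    qed
  qed
  have "\<exists>k. uncountable {i \<in> U. card (F i) = k}"
  proof (rule ccontr)
    assume "\<not> ?thesis"
    then have "countable (\<Union>k. {i \<in> U. card (F i) = k})" by simp
    moreover have "(\<Union>k. {i \<in> U. card (F i) = k}) = U" by blast
    ultimately show False using assms(1) by simp
  qed
  then obtain k where k: "uncountable {i \<in> U. card (F i) = k}" by blast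
  have "\<forall>i\<in>{i \<in> U. card (F i) = k}. finite (F i) \<and> card (F i) = k"
    using assms(2) by simp
  from *[OF k this] obtain R where R: "finite R"
    "\<forall>Z. countable Z \<and> Z \<inter> R = {} \<longrightarrow>
      uncountable {i \<in> {i \<in> U. card (F i) = k}. F i \<inter> Z = {}}"
    by (elim exE conjE)
  have "uncountable {i \<in> U. F i \<inter> Z = {}}" if "countable Z" "Z \<inter> R = {}" for Z
  proof -
    have "{i \<in> {i \<in> U. card (F i) = k}. F i \<inter> Z = {}} \<subseteq> {i \<in> U. F i \<inter> Z = {}}" by blast
    then show ?thesis
      by (rule uncountable_superset) (use R(2) that in simp)
  qed
  with R(1) show ?thesis by blast
qed

text \<open>The values are chosen one after the other. When \<open>r n\<close> is chosen, \<open>F n (r n)\<close> must avoid the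
  earlier pairs \<open>(m, r m)\<close>; uncountably many values do so provided that these pairs lie
  outside the root of the family \<open>F n\<close>. For this reason every pair \<open>(n, r n)\<close> is kept outside the
  countable union of all the roots, those of later families included.\<close>

lemma free_transversal:
  fixes F :: "nat \<Rightarrow> 'b \<Rightarrow> (nat \<times> 'b) set"
  assumes U: "\<And>n. uncountable (U n)"
    and fin: "\<And>n r. r \<in> U n \<Longrightarrow> finite (F n r)"
  shows "\<exists>r. \<forall>n. r n \<in> U n \<and> (\<forall>m. m \<noteq> n \<longrightarrow> (m, r m) \<notin> F n (r n))"
proof -
  have "\<exists>R. finite R \<and>
      (\<forall>Z. countable Z \<and> Z \<inter> R = {} \<longrightarrow> uncountable {r \<in> U n. F n r \<inter> Z = {}})" for n
    by (rule uncountable_finite_sets_root[OF U fin])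
  then have "\<exists>R. \<forall>n. finite (R n) \<and>
      (\<forall>Z. countable Z \<and> Z \<inter> R n = {} \<longrightarrow> uncountable {r \<in> U n. F n r \<inter> Z = {}})"
    by (intro choice allI)
  then obtain R where R: "\<And>n. finite (R n)"
    "\<And>n Z. countable Z \<Longrightarrow> Z \<inter> R n = {} \<Longrightarrow> uncountable {r \<in> U n. F n r \<inter> Z = {}}"
    by auto
  define P where "P f n r \<longleftrightarrow> r \<in> U n \<and> (n, r) \<notin> (\<Union>k. R k) \<and>
    (\<forall>m<n. (n, r) \<notin> F m (f m)) \<and> (\<forall>m<n. (m, f m) \<notin> F n r)" for f n r
  have "\<exists>r. \<forall>n. P r n (r n)"
  proof (rule dependent_wellorder_choice)
    fix n r and f g :: "nat \<Rightarrow> 'b"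
    assume "\<And>m. m < n \<Longrightarrow> f m = g m"
    then show "P f n r = P g n r" by (simp add: P_def cong: conj_cong)
  next
    fix n f assume f: "\<And>m. m < n \<Longrightarrow> P f m (f m)"
    let ?Z = "(\<lambda>m. (m, f m)) ` {..<n}"
    let ?B = "(\<Union>k. R k) \<union> (\<Union>m<n. F m (f m))"
    have "countable ?B"
    proof -
      have "finite (F m (f m))" if "m < n" for m using f[OF that] fin by (simp add: P_def)
      then show ?thesis using R(1) by (auto intro!: countable_Un countable_UN intro: countable_finite)
    qed
    then have "countable (snd ` ?B)" by (rule countable_image)
    moreover have "uncountable {r \<in> U n. F n r \<inter> ?Z = {}}"
    proof (rule R(2))
      show "?Z \<inter> R n = {}" using f by (fastforce simp: P_def)
    qed simp
    ultimately have "\<not> {r \<in> U n. F n r \<inter> ?Z = {}} \<subseteq> snd ` ?B"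
      by (metis countable_subset[of "{r \<in> U n. F n r \<inter> ?Z = {}}" "snd ` ?B"])
    then obtain r where "r \<in> U n" "F n r \<inter> ?Z = {}" "r \<notin> snd ` ?B" by blast
    moreover from this(3) have "(n, r) \<notin> ?B" by force
    ultimately have "P f n r" unfolding P_def by blast
    then show "\<exists>r. P f n r" ..
  qed
  then obtain r where r: "\<And>n. P r n (r n)" by blast
  show ?thesis
  proof (intro exI allI conjI impI)
    show "r n \<in> U n" for n using r[of n] by (simp add: P_def)
    show "(m, r m) \<notin> F n (r n)" if "m \<noteq> n" for m n
      using r[of n] r[of m] that by (cases m n rule: linorder_cases) (simp_all add: P_def)
  qed
qed

section \<open>Every generating family contains an independent sequence\<close>

abbreviation origin :: "nat \<Rightarrow> real" where
  "origin \<equiv> \<lambda>_. 0"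

text \<open>The sets that do not separate two given points form a subalgebra. If it contained \<open>G\<close>, it
  would be everything, yet the fibre over \<open>r\<close> separates these two points.\<close>

lemma generators_separate:
  assumes "generates (set_lattice fibre_algebra) G" "r \<noteq> 0"
  shows "\<exists>g\<in>G. (origin \<in> g) \<noteq> (origin(n := r) \<in> g)"
proof (rule ccontr)
  assume not: "\<not> ?thesis"
  let ?S = "{A \<in> fibre_algebra. origin \<in> A \<longleftrightarrow> origin(n := r) \<in> A}"
  have "algebra UNIV ?S"
    by (auto simp: algebra_iff_Int Compl_eq_Diff_UNIV[symmetric] intro: fibre_algebra.intros)
  moreover have "G \<subseteq> ?S"
    using not assms(1) by (auto simp: generates_set_lattice[OF algebra_fibre_algebra])
  moreover have "?S \<subseteq> fibre_algebra" by (rule Collect_restrict)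
  ultimately have "?S = fibre_algebra"
    using assms(1)[unfolded generates_set_lattice[OF algebra_fibre_algebra]]
    by (elim conjE allE[of _ ?S] impE) simp_all
  with fibre_algebra.fibre[OF assms(2), of n] have "coordinate_fibre n r \<in> ?S" by simp
  then show False using assms(2) by (simp add: coordinate_fibre_def)
qed

lemma generators_independent_sequence:
  assumes G: "generates (set_lattice fibre_algebra) G"
  shows "\<exists>a :: nat \<Rightarrow> _. range a \<subseteq> G \<and> independent_family (set_lattice fibre_algebra) UNIV a"
proof -
  have sub: "G \<subseteq> fibre_algebra"
    using G by (simp add: generates_set_lattice[OF algebra_fibre_algebra])
  have "\<forall>A\<in>fibre_algebra. \<exists>F. finite F \<and> F \<subseteq> UNIV \<times> (- {0}) \<and> determined_by F A"
    using finite_support by blast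
  from bchoice[OF this] obtain S where
    S: "\<And>A. A \<in> fibre_algebra \<Longrightarrow>
          finite (S A) \<and> S A \<subseteq> UNIV \<times> (- {0}) \<and> determined_by (S A) A"
    by auto
  define g where "g n r = (SOME A. A \<in> G \<and> (origin \<in> A) \<noteq> (origin(n := r) \<in> A))"
    for n and r :: real
  have g: "g n r \<in> G \<and> (origin \<in> g n r) \<noteq> (origin(n := r) \<in> g n r)" if "r \<noteq> 0" for n r
    unfolding g_def by (rule someI_ex) (use generators_separate[OF G that] in \<open>simp add: Bex_def\<close>)
  define F where "F n r = S (g n r)" for n r
  have gF: "g n r \<in> G \<and> ((origin \<in> g n r) \<noteq> (origin(n := r) \<in> g n r)) \<and>
      finite (F n r) \<and> F n r \<subseteq> UNIV \<times> (- {0}) \<and> determined_by (F n r) (g n r)"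
    if "r \<noteq> 0" for n r
    using g[OF that, of n] S[of "g n r"] sub by (auto simp: F_def)
  have "uncountable (- {0 :: real})"
    using uncountable_minus_countable[OF uncountable_UNIV_real, of "{0}"]
    by (simp add: Compl_eq_Diff_UNIV)
  then have "\<exists>r. \<forall>n. r n \<in> - {0} \<and> (\<forall>m. m \<noteq> n \<longrightarrow> (m, r m) \<notin> F n (r n))"
    using gF by (intro free_transversal) simp_all
  then obtain r where r: "\<And>n. r n \<noteq> 0" "\<And>m n. m \<noteq> n \<Longrightarrow> (m, r m) \<notin> F n (r n)"
    by auto
  define a where "a n = g n (r n)" for n
  have a: "a n \<in> G" "(origin \<in> a n) \<noteq> (origin(n := r n) \<in> a n)"
    "F n (r n) \<subseteq> UNIV \<times> (- {0})" "determined_by (F n (r n)) (a n)" for n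
    using gF[of "r n" n] r(1)[of n] by (simp_all add: a_def)
  define switch :: "nat set \<Rightarrow> nat \<Rightarrow> real" where "switch J m = (if m \<in> J then r m else 0)" for J m
  \<comment> \<open>On the cube of all points \<open>switch J\<close>, the set \<open>a n\<close> only sees coordinate \<open>n\<close>: its tests at
    another coordinate \<open>m\<close> are for values other than \<open>0\<close> and \<open>r m\<close>, so they all fail.\<close>
  have switch: "switch J \<in> a n \<longleftrightarrow> (if n \<in> J then origin(n := r n) else origin) \<in> a n" for J n
  proof -
    have "switch J m = s \<longleftrightarrow> (if n \<in> J then origin(n := r n) else origin) m = s"
      if "(m, s) \<in> F n (r n)" for m s
    proof -
      have "s \<noteq> 0" using that a(3)[of n] by auto
      moreover have "s \<noteq> r m" if "m \<noteq> n" using r(2)[OF that] \<open>(m, s) \<in> F n (r n)\<close> by auto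
      ultimately show ?thesis by (auto simp: switch_def)
    qed
    then show ?thesis
      using a(4)[of n, unfolded determined_by_def, rule_format,
          of "switch J" "if n \<in> J then origin(n := r n) else origin"]
      by blast
  qed
  have "independent_family (set_lattice fibre_algebra) UNIV a"
  proof -
    have "\<exists>x. (\<forall>n\<in>I'. x \<in> a n) \<and> (\<forall>n\<in>I''. x \<notin> a n)" if "I' \<inter> I'' = {}" for I' I''
    proof -
      \<comment> \<open>Switching coordinate \<open>n\<close> flips membership in \<open>a n\<close>, so it is switched exactly when the
        origin is on the wrong side of \<open>a n\<close>.\<close>
      define J where "J = {n. (n \<in> I') \<noteq> (origin \<in> a n)}"
      have "switch J \<in> a n \<longleftrightarrow> n \<in> I'" for n
        using switch[of J n] a(2)[of n] by (auto simp: J_def)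
      with that show ?thesis by (intro exI[of _ "switch J"]) auto
    qed
    moreover have "a ` UNIV \<subseteq> fibre_algebra" using a(1) sub by auto
    ultimately show ?thesis
      by (simp add: independent_family_set_lattice[OF algebra_fibre_algebra])
  qed
  with a(1) show ?thesis by blast
qed

theorem proposition6p6:
  shows "\<exists>L :: (nat \<Rightarrow> real) set gorder. boolean_lattice L \<and> UWRN L \<and> \<not> SWRN L"
proof -
  have "\<not> SWRN (set_lattice fibre_algebra)"
    using generators_independent_sequence unfolding SWRN_def by blast
  then show ?thesis
    using boolean_lattice_set_lattice[OF algebra_fibre_algebra] UWRN_fibre_algebra by blast
qed

end
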